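(* Consider the system of conservation laws $$\partial_t u+\partial_x q=0,\qquad \partial_t q+\partial_x\Big((2u-1)q+\frac{u^2}{2}-\frac{2u^3}{3}\Big)=0 .$$ Let $(u_L,q_L)$ and $(u_R,q_R)$ be a left state and a right state such that both are above the critical curve $q_{crit}(u)=\frac{u^2}{2}$, i.e. $q_L\ge u_L^2/2$ and $q_R\ge u_R^2/2$. Then the states $(u_L,q_L)$ and $(u_R,q_R)$ can be connected by Lax admissible shocks and rarefaction waves via a middle state $(u_M,q_M)$ belonging to the domain $q>u^2/2$.
   Context: The characteristic speeds of the system are $$\lambda_{\mp}(u,q)=\frac{2u-1\mp\sqrt{8q-4u^2+1}}{2};$$ the first family corresponds to $\lambda_-$, the second to $\lambda_+$. A Lax admissible shock of the first (resp. second) family from a left state $(u_l,q_l)$ to a right state $(u_r,q_r)$ is a jump with speed $c$ satisfying the Rankine–Hugoniot conditions $$c(u_l-u_r)=q_l-q_r,\qquad c(q_l-q_r)=\Big((2u_l-1)q_l+\tfrac{u_l^2}{2}-\tfrac{2u_l^3}{3}\Big)-\Big((2u_r-1)q_r+\tfrac{u_r^2}{2}-\tfrac{2u_r^3}{3}\Big)$$ and the Lax condition $\lambda_{-}(u_l,q_l)\ge c\ge\lambda_{-}(u_r,q_r)$ (resp. the same with $\lambda_+$). A rarefaction wave of the first (resp. second) family from $(u_l,q_l)$ to $(u_r,q_r)$ exists when $u_r>u_l$ and $(u_r,q_r)$ lies on the solution curve of $$\frac{dq}{du}=\lambda_-(u,q)\quad\Big(\text{resp. }\frac{dq}{du}=\lambda_+(u,q)\Big),\qquad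 q(u_l)=q_l .$$ "Connected via a middle state $(u_M,q_M)$" means: $(u_L,q_L)$ is connected to $(u_M,q_M)$ by a shock or rarefaction wave of the first family (possibly of zero strength), and $(u_M,q_M)$ is connected to $(u_R,q_R)$ by a shock or rarefaction wave of the second family (possibly of zero strength).
   Formalization: If the right state lies on the critical curve and the first-family rarefaction from the left state (possibly of zero strength) meets that curve at some v ≤ u_R, the strict claim fails, e.g. (0,0), (1,1/2); there the middle state is only shown to lie on q=u²/2. *)

theory Defs
  imports "HOL-Analysis.Analysis"
begin

text \<open>
  The system of conservation laws is \<open>\<partial>\<^sub>t u + \<partial>\<^sub>x q = 0\<close>, \<open>\<partial>\<^sub>t q + \<partial>\<^sub>x (flux u q) = 0\<close>.
\<close>

definition flux :: "real \<Rightarrow> real \<Rightarrow> real" where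
  "flux u q = (2 * u - 1) * q + u\<^sup>2 / 2 - 2 * u ^ 3 / 3"

definition q_crit :: "real \<Rightarrow> real" where
  "q_crit u = u\<^sup>2 / 2"

text \<open>
  The characteristic speeds are the eigenvalues of the Jacobian matrix with rows
  \<open>(0, 1)\<close> and \<open>(2 * q + u - 2 * u\<^sup>2, 2 * u - 1)\<close>; they are real exactly where \<open>discr u q \<ge> 0\<close>.
  Since \<^const>\<open>sqrt\<close> is total (and odd) on the reals, this has to be required explicitly
  wherever a characteristic speed is used.  It holds on \<open>q \<ge> q_crit u\<close>, where \<open>discr u q \<ge> 1\<close>.
\<close>

definition discr :: "real \<Rightarrow> real \<Rightarrow> real" where
  "discr u q = 8 * q - 4 * u\<^sup>2 + 1"

datatype family = First | Second

fun char_speed :: "family \<Rightarrow> real \<Rightarrow> real \<Rightarrow> real" where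
  "char_speed First u q = (2 * u - 1 - sqrt (discr u q)) / 2"
| "char_speed Second u q = (2 * u - 1 + sqrt (discr u q)) / 2"

definition rankine_hugoniot :: "real \<Rightarrow> real \<Rightarrow> real \<Rightarrow> real \<Rightarrow> real \<Rightarrow> bool" where
  "rankine_hugoniot c ul ql ur qr \<longleftrightarrow>
     c * (ul - ur) = ql - qr \<and> c * (ql - qr) = flux ul ql - flux ur qr"

definition lax_shock :: "family \<Rightarrow> real \<Rightarrow> real \<Rightarrow> real \<Rightarrow> real \<Rightarrow> bool" where
  "lax_shock k ul ql ur qr \<longleftrightarrow>
     discr ul ql \<ge> 0 \<and> discr ur qr \<ge> 0 \<and>
     (\<exists>c. rankine_hugoniot c ul ql ur qr \<and>
          char_speed k ul ql \<ge> c \<and> c \<ge> char_speed k ur qr)"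

definition rarefaction :: "family \<Rightarrow> real \<Rightarrow> real \<Rightarrow> real \<Rightarrow> real \<Rightarrow> bool" where
  "rarefaction k ul ql ur qr \<longleftrightarrow>
     ul < ur \<and>
     (\<exists>Q :: real \<Rightarrow> real. Q ul = ql \<and> Q ur = qr \<and>
        (\<forall>u\<in>{ul..ur}. discr u (Q u) \<ge> 0 \<and>
           (Q has_real_derivative char_speed k u (Q u)) (at u within {ul..ur})))"

definition wave :: "family \<Rightarrow> real \<Rightarrow> real \<Rightarrow> real \<Rightarrow> real \<Rightarrow> bool" where
  "wave k ul ql ur qr \<longleftrightarrow>
     lax_shock k ul ql ur qr \<or> rarefaction k ul ql ur qr \<or> (ul = ur \<and> ql = qr)"

definition connected_via ::
  "real \<Rightarrow> real \<Rightarrow> real \<Rightarrow> real \<Rightarrow> real \<Rightarrow> real \<Rightarrow> bool" where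
  "connected_via uL qL uM qM uR qR \<longleftrightarrow> wave First uL qL uM qM \<and> wave Second uM qM uR qR"

text \<open>
  The critical curve is itself an integral curve of the second family, because
  \<open>char_speed Second u (q_crit u) = u\<close>.  A right state on it can therefore be joined to any
  state of the curve further to the left by a rarefaction wave that runs along the curve.  The
  following predicate says that the first-family rarefaction curve from the left state
  (possibly of zero length) meets the critical curve at some \<open>v \<le> uR\<close> while the right state lies
  on the critical curve.  For such data the middle state is the meeting point \<open>(v, q_crit v)\<close>
  and hence lies on the boundary of \<open>q > q_crit u\<close>, not inside.  For instance, \<open>(0, 0)\<close> and
  \<open>(1, 1/2)\<close> cannot be connected via any middle state with \<open>q > q_crit u\<close>.
\<close>

definition meets_at_critical_curve :: "real \<Rightarrow> real \<Rightarrow> real \<Rightarrow> real \<Rightarrow> bool" where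
  "meets_at_critical_curve uL qL uR qR \<longleftrightarrow>
     qR = q_crit uR \<and>
     (\<exists>v\<le>uR. (uL = v \<and> qL = q_crit v) \<or> rarefaction First uL qL v (q_crit v))"

end

theory Submission
  imports Defs
begin

text \<open>
  Measure a state by its excess \<open>w = q - u\<^sup>2 / 2 \<ge> 0\<close> over the critical curve.  In the
  coordinates \<open>(u, w)\<close> both wave curves are invariant under translation in \<open>u\<close>: with
  \<open>s = sqrt (1 + 8 w)\<close> the characteristic speeds are \<open>u + (-1 \<mp> s) / 2\<close>, so rarefaction
  curves solve the autonomous equation \<open>dw/du = (-1 \<mp> s) / 2\<close>, and a jump with
  \<open>h = \<Delta>u \<noteq> 0\<close> and \<open>\<sigma> = \<Delta>w / h\<close> satisfies the Rankine--Hugoniot conditions iff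
  \<open>\<sigma>\<^sup>2 + (1 - h) \<sigma> = 2 w + h\<^sup>2 / 12\<close>, where \<open>w\<close> belongs to the state from which the
  jump is measured.  The two roots \<open>\<sigma>\<close> of this quadratic equation belong to the two families.

  The states reachable from the left state by a first-family wave therefore form the graph of a
  function \<open>f\<close> of \<open>u\<close>: on the left of \<open>uL\<close> it consists of shocks and grows without bound as
  \<open>u\<close> tends to minus infinity; on the right of \<open>uL\<close> it consists of rarefactions and decreases to
  \<open>0\<close> at a finite \<open>v\<close> (\<open>first_wave_curve\<close>).  The states from which the right state is reachable
  by a second-family wave form the graph of a nonnegative function \<open>g\<close> on the whole line, made of
  shocks on the right of \<open>uR\<close> and of rarefactions, with excess at most that of the right state, on
  the left (\<open>second_wave_curve\<close>).  Hence \<open>f > g\<close> far to the left and \<open>f v = 0 \<le> g v\<close>, and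
  the intermediate value theorem yields a crossing, which is the middle state.

  The crossing can lie on the critical curve only where \<open>f\<close> and \<open>g\<close> both vanish, that is at \<open>v\<close>,
  with \<open>qR = q_crit uR\<close> and \<open>v \<le> uR\<close>.  This is exactly the exceptional configuration, where the
  critical curve itself serves as the second rarefaction wave.
\<close>

section \<open>Excess over the critical curve\<close>

fun family_sign :: "family \<Rightarrow> real" where
  "family_sign First = -1"
| "family_sign Second = 1"

lemma discr_excess: "discr u (q_crit u + w) = 1 + 8 * w"
  by (simp add: discr_def q_crit_def field_simps)

lemma char_speed_excess:
  "char_speed k u (q_crit u + w) = u + (family_sign k * sqrt (1 + 8 * w) - 1) / 2"
  by (cases k; simp only: char_speed.simps family_sign.simps discr_excess; argo)

section \<open>Shock curves\<close>

lemma rankine_hugoniot_commute: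
  "rankine_hugoniot c ul ql ur qr \<longleftrightarrow> rankine_hugoniot c ur qr ul ql"
  unfolding rankine_hugoniot_def by (auto simp: algebra_simps)

text \<open>
  In terms of the excess the flux is \<open>(2 u - 1) w + u\<^sup>3 / 3\<close>.  Subtracting the parts of both
  sides that depend on the mean velocity \<open>u + h / 2\<close> leaves \<open>h\<close> times the quadratic equation.
\<close>

lemma rankine_hugoniot_excess:
  assumes "\<sigma>\<^sup>2 + (1 - h) * \<sigma> = 2 * w + h\<^sup>2 / 12"
  shows "rankine_hugoniot (u + h / 2 + \<sigma>) u (q_crit u + w) (u + h) (q_crit (u + h) + (w + \<sigma> * h))"
proof -
  have "h * \<sigma>\<^sup>2 = h * (2 * w + h\<^sup>2 / 12 - (1 - h) * \<sigma>)"
    using assms by algebra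
  then show ?thesis
    unfolding rankine_hugoniot_def flux_def q_crit_def
    by (simp add: power2_eq_square power3_eq_cube field_simps)
qed

text \<open>
  One of the two roots of that quadratic equation, for a jump of \<open>u\<close> by \<open>h\<close> away from a
  given state of excess \<open>w\<close>.  First-family shocks are described from the left state (\<open>h < 0\<close>) and
  second-family shocks from the right state (\<open>h > 0\<close>).
\<close>

definition hugoniot_slope :: "family \<Rightarrow> real \<Rightarrow> real \<Rightarrow> real" where
  "hugoniot_slope k w h = (h - 1 + family_sign k * sqrt (1 + 8 * w - 2 * h + 4 * h\<^sup>2 / 3)) / 2"

definition hugoniot_excess :: "family \<Rightarrow> real \<Rightarrow> real \<Rightarrow> real" where
  "hugoniot_excess k w h = w + hugoniot_slope k w h * h"

lemma hugoniot_radicand_ge: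
  fixes w h :: real
  assumes "w \<ge> 0"
  shows "1 + 8 * w - 2 * h + 4 * h\<^sup>2 / 3 \<ge> 1 / 4"
proof -
  have "0 \<le> (4 * h - 3)\<^sup>2 / 12" by simp
  also have "\<dots> = 4 * h\<^sup>2 / 3 - 2 * h + 3 / 4" by (simp add: power2_eq_square field_simps)
  finally show ?thesis using assms by linarith
qed

lemma hugoniot_slope_root:
  assumes "w \<ge> 0"
  shows "(hugoniot_slope k w h)\<^sup>2 + (1 - h) * hugoniot_slope k w h = 2 * w + h\<^sup>2 / 12"
proof -
  define D where "D = sqrt (1 + 8 * w - 2 * h + 4 * h\<^sup>2 / 3)"
  have "D\<^sup>2 = 1 + 8 * w - 2 * h + 4 * h\<^sup>2 / 3"
    using hugoniot_radicand_ge[OF assms, of h] by (simp add: D_def)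
  then show ?thesis
    unfolding hugoniot_slope_def D_def[symmetric]
    by (cases k) (simp_all add: power2_eq_square field_simps)
qed

lemma hugoniot_excess_0 [simp]: "hugoniot_excess k w 0 = w"
  by (simp add: hugoniot_excess_def)

lemma continuous_on_hugoniot_excess:
  "continuous_on A (\<lambda>u. hugoniot_excess k w (u - u0))"
  unfolding hugoniot_excess_def hugoniot_slope_def by (intro continuous_intros) auto

text \<open>
  For \<open>h \<le> 0\<close> the slope is at most \<open>-1/2\<close>, because the square root in it is nonnegative.  The
  resulting linear growth shows that strong shocks reach arbitrarily large excess.
\<close>

lemma first_hugoniot_excess_ge:
  assumes "w \<ge> 0" "h \<le> 0"
  shows "hugoniot_excess First w h \<ge> w - h / 2"
proof -
  have "sqrt (1 + 8 * w - 2 * h + 4 * h\<^sup>2 / 3) \<ge> h"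
    using hugoniot_radicand_ge[OF assms(1), of h] by (intro order_trans[OF assms(2)]) simp
  then have "hugoniot_slope First w h \<le> - 1 / 2"
    using assms(2) unfolding hugoniot_slope_def by simp
  then have "hugoniot_slope First w h * h \<ge> (- 1 / 2) * h"
    using assms(2) by (rule mult_right_mono_neg)
  then show ?thesis unfolding hugoniot_excess_def by simp
qed

text \<open>
  The radicand equals \<open>(1 - h)\<^sup>2 + h\<^sup>2 / 3 + 8 w\<close>, so its square root exceeds \<open>1 - h\<close>.
\<close>

lemma second_hugoniot_excess_gt:
  assumes "w \<ge> 0" "h > 0"
  shows "hugoniot_excess Second w h > w"
proof -
  have "(1 - h)\<^sup>2 < 1 + 8 * w - 2 * h + 4 * h\<^sup>2 / 3"
    using assms by (simp add: power2_eq_square field_simps add_pos_nonneg)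
  then have "1 - h < sqrt (1 + 8 * w - 2 * h + 4 * h\<^sup>2 / 3)"
    by (rule real_less_rsqrt)
  then have "hugoniot_slope Second w h > 0"
    unfolding hugoniot_slope_def by simp
  then show ?thesis using assms(2) unfolding hugoniot_excess_def by simp
qed

text \<open>
  With \<open>D\<close> the square root in the slope and \<open>sl\<close>, \<open>sr\<close> the square roots in the characteristic
  speeds, the Lax conditions reduce to \<open>D \<ge> sl + 2 h\<close> and \<open>sr \<ge> D\<close>.
\<close>

lemma lax_shock_First_hugoniot:
  assumes "w \<ge> 0" "h < 0"
  shows "lax_shock First u (q_crit u + w) (u + h) (q_crit (u + h) + hugoniot_excess First w h)"
proof -
  define \<sigma> where "\<sigma> = hugoniot_slope First w h"
  define D where "D = sqrt (1 + 8 * w - 2 * h + 4 * h\<^sup>2 / 3)"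
  have \<sigma>: "\<sigma> = (h - 1 - D) / 2" by (simp add: \<sigma>_def hugoniot_slope_def D_def)
  have D2: "D\<^sup>2 = 1 + 8 * w - 2 * h + 4 * h\<^sup>2 / 3"
    and D0: "D \<ge> 0"
    using hugoniot_radicand_ge[OF assms(1), of h] by (simp_all add: D_def)
  have rh: "rankine_hugoniot (u + h / 2 + \<sigma>) u (q_crit u + w) (u + h) (q_crit (u + h) + (w + \<sigma> * h))"
    by (rule rankine_hugoniot_excess) (simp add: \<sigma>_def hugoniot_slope_root assms)
  have l: "sqrt (1 + 8 * w) \<le> D"
    unfolding D_def using assms by (intro real_sqrt_le_mono) (simp add: order_trans[of "3 * h" 0])
  have "D\<^sup>2 \<le> 1 + 8 * (w + \<sigma> * h)"
  proof -
    have "h * D \<le> 0" using assms D0 by (simp add: mult_nonpos_nonneg)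
    moreover have "1 + 8 * (w + \<sigma> * h) - D\<^sup>2 = 8 * h\<^sup>2 / 3 - 2 * h - 4 * (h * D)"
      unfolding D2 unfolding \<sigma> by (simp add: power2_eq_square field_simps)
    ultimately show ?thesis using assms(2) zero_le_power2[of h] by linarith
  qed
  then have r: "D \<le> sqrt (1 + 8 * (w + \<sigma> * h))"
    by (rule real_le_rsqrt)
  have "discr (u + h) (q_crit (u + h) + (w + \<sigma> * h)) \<ge> 0"
    using \<open>D\<^sup>2 \<le> 1 + 8 * (w + \<sigma> * h)\<close> zero_le_power2[of D] unfolding discr_excess by linarith
  moreover have "discr u (q_crit u + w) \<ge> 0"
    using assms unfolding discr_excess by simp
  moreover have "char_speed First u (q_crit u + w) \<ge> u + h / 2 + \<sigma>"
    using l assms(2) unfolding char_speed_excess \<sigma> by (simp add: field_simps)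
  moreover have "u + h / 2 + \<sigma> \<ge> char_speed First (u + h) (q_crit (u + h) + (w + \<sigma> * h))"
    using r unfolding char_speed_excess by (simp add: \<sigma> field_simps)
  ultimately show ?thesis
    using rh unfolding lax_shock_def hugoniot_excess_def \<sigma>_def by blast
qed

text \<open>
  Here \<open>h\<close> is the jump from right to left, and the Lax conditions reduce to \<open>sl \<ge> D\<close> and
  \<open>D \<ge> sr - 2 h\<close>.  The first needs the lower bound \<open>D \<ge> 1/2\<close> and the second \<open>sr \<ge> 1\<close>; these are
  the points where \<open>w \<ge> 0\<close> enters.
\<close>

lemma lax_shock_Second_hugoniot:
  assumes "w \<ge> 0" "h > 0"
  shows "lax_shock Second (u + h) (q_crit (u + h) + hugoniot_excess Second w h) u (q_crit u + w)"
proof -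
  define \<sigma> where "\<sigma> = hugoniot_slope Second w h"
  define D where "D = sqrt (1 + 8 * w - 2 * h + 4 * h\<^sup>2 / 3)"
  define s where "s = sqrt (1 + 8 * w)"
  have \<sigma>: "\<sigma> = (h - 1 + D) / 2" by (simp add: \<sigma>_def hugoniot_slope_def D_def)
  have D2: "D\<^sup>2 = 1 + 8 * w - 2 * h + 4 * h\<^sup>2 / 3"
    using hugoniot_radicand_ge[OF assms(1), of h] by (simp add: D_def)
  have D: "D \<ge> 1 / 2"
    unfolding D_def using hugoniot_radicand_ge[OF assms(1), of h]
    by (intro real_le_rsqrt) (simp add: power2_eq_square)
  have s: "s \<ge> 1" "s\<^sup>2 = 1 + 8 * w"
    using assms by (simp_all add: s_def)
  have rh: "rankine_hugoniot (u + h / 2 + \<sigma>) (u + h) (q_crit (u + h) + (w + \<sigma> * h)) u (q_crit u + w)"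
    by (subst rankine_hugoniot_commute, rule rankine_hugoniot_excess)
       (simp add: \<sigma>_def hugoniot_slope_root assms)
  have "D\<^sup>2 \<le> 1 + 8 * (w + \<sigma> * h)"
  proof -
    have "h * (8 * h / 3 - 2 + 4 * D) \<ge> 0" using assms D by simp
    moreover have "1 + 8 * (w + \<sigma> * h) - D\<^sup>2 = h * (8 * h / 3 - 2 + 4 * D)"
      unfolding D2 unfolding \<sigma> by (simp add: power2_eq_square field_simps)
    ultimately show ?thesis by linarith
  qed
  then have l: "D \<le> sqrt (1 + 8 * (w + \<sigma> * h))"
    by (rule real_le_rsqrt)
  have r: "s - 2 * h \<le> D"
  proof (cases "s \<le> 2 * h")
    case True
    then show ?thesis using D by simp
  next
    case False
    have "h * (4 * s - 2 - 8 * h / 3) \<ge> 0"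
      using False s assms by simp
    moreover have "D\<^sup>2 - (s - 2 * h)\<^sup>2 = h * (4 * s - 2 - 8 * h / 3)"
      using D2 s(2) by (simp add: power2_eq_square field_simps)
    ultimately have "(s - 2 * h)\<^sup>2 \<le> D\<^sup>2" by linarith
    then show ?thesis using D by (auto intro: power2_le_imp_le)
  qed
  have "discr (u + h) (q_crit (u + h) + (w + \<sigma> * h)) \<ge> 0"
    using \<open>D\<^sup>2 \<le> 1 + 8 * (w + \<sigma> * h)\<close> zero_le_power2[of D] unfolding discr_excess by linarith
  moreover have "discr u (q_crit u + w) \<ge> 0"
    using assms unfolding discr_excess by simp
  moreover have "char_speed Second (u + h) (q_crit (u + h) + (w + \<sigma> * h)) \<ge> u + h / 2 + \<sigma>"
    using l unfolding char_speed_excess by (simp add: \<sigma> field_simps)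
  moreover have "u + h / 2 + \<sigma> \<ge> char_speed Second u (q_crit u + w)"
    using r unfolding char_speed_excess \<sigma> s_def[symmetric] by (simp add: field_simps)
  ultimately show ?thesis
    using rh unfolding lax_shock_def hugoniot_excess_def \<sigma>_def by blast
qed

section \<open>Rarefaction curves\<close>

text \<open>
  In the variable \<open>s = sqrt (1 + 8 w)\<close> the rarefaction equation \<open>dw/du = (\<epsilon> s - 1) / 2\<close>
  becomes \<open>s ds/du = 2 (\<epsilon> s - 1)\<close>, where \<open>\<epsilon>\<close> is the sign of the family.
\<close>

lemma rarefactionI:
  assumes "ul < ur"
    and S: "\<And>u. ul \<le> u \<Longrightarrow> u \<le> ur \<Longrightarrow> S u > 0 \<and>
              (S has_real_derivative 2 * (family_sign k * S u - 1) / S u) (at u)"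
  shows "rarefaction k ul (q_crit ul + ((S ul)\<^sup>2 - 1) / 8) ur (q_crit ur + ((S ur)\<^sup>2 - 1) / 8)"
proof -
  define Q where "Q u = q_crit u + ((S u)\<^sup>2 - 1) / 8" for u
  have "discr u (Q u) \<ge> 0 \<and>
      (Q has_real_derivative char_speed k u (Q u)) (at u within {ul..ur})"
    if u: "u \<in> {ul..ur}" for u
  proof
    have pos: "S u > 0"
      and der: "(S has_real_derivative 2 * (family_sign k * S u - 1) / S u) (at u)"
      using S[of u] u by auto
    show "discr u (Q u) \<ge> 0" unfolding Q_def discr_excess by (simp add: diff_divide_distrib)
    have "sqrt (1 + 8 * (((S u)\<^sup>2 - 1) / 8)) = S u"
      using pos by (simp add: diff_divide_distrib)
    then have "char_speed k u (Q u) = u + (family_sign k * S u - 1) / 2"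
      unfolding Q_def char_speed_excess by presburger
    moreover have "(Q has_real_derivative u + (family_sign k * S u - 1) / 2) (at u)"
      unfolding Q_def[abs_def] q_crit_def
      using pos by (auto intro!: derivative_eq_intros der simp: field_simps)
    ultimately show "(Q has_real_derivative char_speed k u (Q u)) (at u within {ul..ur})"
      by (simp add: has_field_derivative_at_within)
  qed
  then show ?thesis
    using assms(1) unfolding rarefaction_def Q_def[symmetric] by blast
qed

text \<open>
  Autonomous scalar equations are solved by inverting a primitive: this is the inverse.
\<close>

lemma increasing_primitive_inverse:
  fixes G g :: "real \<Rightarrow> real"
  assumes der: "\<And>s. s > a \<Longrightarrow> (G has_real_derivative g s) (at s)"
    and pos: "\<And>s. s > a \<Longrightarrow> g s > 0"
  obtains T where "\<And>s. s > a \<Longrightarrow> T (G s) = s"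
    and "\<And>s. s > a \<Longrightarrow> (T has_real_derivative inverse (g s)) (at (G s))"
proof (rule that[of "inv_into {a<..} G"])
  have incr: "G s < G t" if "a < s" "s < t" for s t
    by (rule DERIV_pos_imp_increasing[OF that(2)])
       (use der pos that in \<open>meson less_le_trans\<close>)
  have "inj_on G {a<..}"
    by (rule inj_onI) (metis greaterThan_iff incr linorder_less_linear order_less_irrefl)
  then show inv: "inv_into {a<..} G (G s) = s" if "s > a" for s
    using that by (simp add: inv_into_f_f)
  show "(inv_into {a<..} G has_real_derivative inverse (g s)) (at (G s))" if "s > a" for s
    unfolding has_field_derivative_def
  proof (rule has_derivative_inverse_strong[where f = G and x = s and S = "{a<..}" and f' = "(*) (g s)"])
    show "continuous_on {a<..} G"
      by (intro continuous_at_imp_continuous_on) (auto intro: DERIV_isCont der)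
    show "(G has_derivative (*) (g s)) (at s)"
      using der[OF that] by (simp add: has_field_derivative_def)
    show "(*) (g s) \<circ> (*) (inverse (g s)) = id"
      using pos[OF that] by (auto simp: fun_eq_iff)
  qed (use that inv in auto)
qed

text \<open>
  Separating variables gives \<open>u + (s - ln (1 + s)) / 2 = const\<close> along a rarefaction curve of the
  first family.  The curve reaches \<open>s = 1\<close>, which is the critical curve, with finite nonzero
  slope, at the point \<open>v\<close>.
\<close>

lemma first_rarefaction_profile:
  assumes "s0 \<ge> 1"
  obtains S v where "u0 \<le> v" "S u0 = s0" "S v = 1"
    and "\<And>u. u0 \<le> u \<Longrightarrow> u < v \<Longrightarrow> S u > 1"
    and "\<And>u. u0 \<le> u \<Longrightarrow> u \<le> v \<Longrightarrow> (S has_real_derivative 2 * (- S u - 1) / S u) (at u)"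
proof -
  define G where "G s = (s - ln (1 + s)) / 2" for s :: real
  have G: "(G has_real_derivative s / (2 * (1 + s))) (at s)" if "s > 0" for s
    unfolding G_def[abs_def] using that
    by (auto intro!: derivative_eq_intros simp: field_simps)
  obtain T where T: "\<And>s. s > 0 \<Longrightarrow> T (G s) = s"
      and T': "\<And>s. s > 0 \<Longrightarrow> (T has_real_derivative inverse (s / (2 * (1 + s)))) (at (G s))"
    by (rule increasing_primitive_inverse[of 0 G "\<lambda>s. s / (2 * (1 + s))"]) (rule G, assumption, simp, rule that)
  have cont: "continuous_on {1..s0} G"
    by (intro continuous_at_imp_continuous_on) (auto intro!: DERIV_isCont[OF G])
  define v where "v = u0 + G s0 - G 1"
  define S where "S u = T (u0 + G s0 - u)" for u
  have point: "\<exists>s\<ge>1. G s = u0 + G s0 - u" if "u0 \<le> u" "u \<le> v" for u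
    using IVT'[of G 1 "u0 + G s0 - u" s0] that assms cont unfolding v_def by auto
  show ?thesis
  proof (rule that[of v S])
    have "G 1 \<le> G s0"
    proof (rule DERIV_nonneg_imp_nondecreasing[OF assms])
      show "\<exists>y. (G has_real_derivative y) (at s) \<and> 0 \<le> y" if "1 \<le> s" for s
        using G[of s] that by (intro exI[of _ "s / (2 * (1 + s))"]) simp
    qed
    then show "u0 \<le> v" by (simp add: v_def)
    show "S u0 = s0" "S v = 1" using T assms by (simp_all add: S_def v_def)
    show "S u > 1" if u: "u0 \<le> u" "u < v" for u
    proof -
      obtain s where s: "s \<ge> 1" "G s = u0 + G s0 - u" using point[of u] u by auto
      then have "s \<noteq> 1" using u(2) by (auto simp: v_def)
      then show ?thesis using s T[of s] unfolding S_def by (simp flip: s(2))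
    qed
    show "(S has_real_derivative 2 * (- S u - 1) / S u) (at u)" if u: "u0 \<le> u" "u \<le> v" for u
    proof -
      obtain s where s: "s \<ge> 1" "G s = u0 + G s0 - u" using point[OF u] by blast
      have "(T has_real_derivative inverse (s / (2 * (1 + s)))) (at (u0 + G s0 - u))"
        using T'[of s] s by simp
      then have "(S has_real_derivative inverse (s / (2 * (1 + s))) * (- 1)) (at u)"
        unfolding S_def[abs_def]
        by (rule DERIV_chain2) (auto intro!: derivative_eq_intros)
      moreover have "S u = s" using s T[of s] unfolding S_def by (simp flip: s(2))
      moreover have "inverse (s / (2 * (1 + s))) * (- 1) = 2 * (- s - 1) / s"
        using s(1) by (simp add: field_simps)
      ultimately show ?thesis by (simp only:)
    qed
  qed
qed

text \<open>
  Along a rarefaction curve of the second family \<open>u - (s + ln (s - 1)) / 2\<close> is constant.  Since the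
  logarithm diverges at \<open>s = 1\<close>, the curve extends to all \<open>u \<le> u0\<close> and stays above the critical
  curve, unless it is the critical curve.
\<close>

lemma second_rarefaction_profile:
  assumes "s0 \<ge> 1"
  obtains S where "S u0 = s0" "\<And>u. u \<le> u0 \<Longrightarrow> 1 \<le> S u \<and> S u \<le> s0"
    and "\<And>u. s0 > 1 \<Longrightarrow> u \<le> u0 \<Longrightarrow> S u > 1"
    and "\<And>u. u \<le> u0 \<Longrightarrow> (S has_real_derivative 2 * (S u - 1) / S u) (at u)"
proof (cases "s0 = 1")
  case True
  show ?thesis by (rule that[of "\<lambda>_. 1"]) (use True in auto)
next
  case False
  with assms have s0: "s0 > 1" by simp
  define K where "K s = (s + ln (s - 1)) / 2" for s :: real
  have K: "(K has_real_derivative s / (2 * (s - 1))) (at s)" if "s > 1" for s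
    unfolding K_def[abs_def] using that
    by (auto intro!: derivative_eq_intros simp: field_simps)
  obtain T where T: "\<And>s. s > 1 \<Longrightarrow> T (K s) = s"
      and T': "\<And>s. s > 1 \<Longrightarrow> (T has_real_derivative inverse (s / (2 * (s - 1)))) (at (K s))"
    by (rule increasing_primitive_inverse[of 1 K "\<lambda>s. s / (2 * (s - 1))"]) (rule K, assumption, simp, rule that)
  define S where "S u = T (u - u0 + K s0)" for u
  have point: "\<exists>s. 1 < s \<and> s \<le> s0 \<and> K s = u - u0 + K s0" if "u \<le> u0" for u
  proof -
    define x where "x = u - u0 + K s0"
    \<comment> \<open>The point where \<open>s0 + ln (s - 1) = 2 x\<close>; replacing \<open>s0\<close> by the smaller \<open>s\<close> gives \<open>K s \<le> x\<close>.\<close>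
    define s1 where "s1 = 1 + exp (2 * x - s0)"
    have "2 * x - s0 \<le> ln (s0 - 1)" using that by (simp add: x_def K_def field_simps)
    then have "exp (2 * x - s0) \<le> s0 - 1"
      using s0 by (simp add: ln_ge_iff)
    then have s1: "1 < s1" "s1 \<le> s0" by (simp_all add: s1_def)
    then have "K s1 \<le> x" by (simp add: K_def s1_def)
    moreover have "continuous_on {s1..s0} K"
      by (intro continuous_at_imp_continuous_on) (use s1 in \<open>auto intro!: DERIV_isCont[OF K]\<close>)
    moreover have "x \<le> K s0" using that by (simp add: x_def)
    ultimately obtain s where "s1 \<le> s" "s \<le> s0" "K s = x"
      using IVT'[of K s1 x s0] s1 by auto
    then show ?thesis using s1 unfolding x_def by (intro exI[of _ s]) simp
  qed
  show ?thesis
  proof (rule that[of S])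
    show "S u0 = s0" using T s0 by (simp add: S_def)
    show "S u > 1" if "s0 > 1" and u: "u \<le> u0" for u
    proof -
      obtain s where "1 < s" "K s = u - u0 + K s0" using point[OF u] by blast
      then show ?thesis using T[of s] unfolding S_def by simp
    qed
    show "1 \<le> S u \<and> S u \<le> s0" if u: "u \<le> u0" for u
    proof -
      obtain s where "1 < s" "s \<le> s0" "K s = u - u0 + K s0" using point[OF u] by blast
      then show ?thesis using T[of s] unfolding S_def by simp
    qed
    show "(S has_real_derivative 2 * (S u - 1) / S u) (at u)" if u: "u \<le> u0" for u
    proof -
      obtain s where s: "s > 1" "K s = u - u0 + K s0" using point[OF u] by blast
      have "(T has_real_derivative inverse (s / (2 * (s - 1)))) (at (u - u0 + K s0))"
        using T'[of s] s by simp
      then have "(S has_real_derivative inverse (s / (2 * (s - 1))) * 1) (at u)"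
        unfolding S_def[abs_def]
        by (rule DERIV_chain2) (auto intro!: derivative_eq_intros)
      moreover have "S u = s" using s T[of s] unfolding S_def by (simp flip: s(2))
      ultimately show ?thesis using s(1) by (simp add: field_simps)
    qed
  qed
qed

section \<open>Wave curves\<close>

text \<open>
  The middle states that the left state reaches by a wave of the first family.  The shock branch and
  the rarefaction branch both start with excess \<open>w\<close> at \<open>u0\<close>, so they fit together continuously.
\<close>

lemma first_wave_curve:
  assumes "w \<ge> 0"
  obtains f v where "u0 \<le> v" "continuous_on {..v} f" "f u0 = w" "f v = 0"
    and "\<And>u. u < v \<Longrightarrow> f u > 0"
    and "\<And>u. u \<le> u0 \<Longrightarrow> f u \<ge> w + (u0 - u) / 2"
    and "\<And>u. u < u0 \<Longrightarrow> lax_shock First u0 (q_crit u0 + w) u (q_crit u + f u)"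
    and "\<And>u. u0 < u \<Longrightarrow> u \<le> v \<Longrightarrow> rarefaction First u0 (q_crit u0 + w) u (q_crit u + f u)"
proof -
  obtain S v where Sv: "u0 \<le> v" "S u0 = sqrt (1 + 8 * w)" "S v = 1"
      and S_gt: "\<And>u. u0 \<le> u \<Longrightarrow> u < v \<Longrightarrow> S u > 1"
      and S': "\<And>u. u0 \<le> u \<Longrightarrow> u \<le> v \<Longrightarrow> (S has_real_derivative 2 * (- S u - 1) / S u) (at u)"
    by (rule first_rarefaction_profile[of "sqrt (1 + 8 * w)" u0]) (use assms in simp, rule that)
  define f where "f u = (if u < u0 then hugoniot_excess First w (u - u0) else ((S u)\<^sup>2 - 1) / 8)" for u
  have start: "((S u0)\<^sup>2 - 1) / 8 = w" using Sv assms by simp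
  show ?thesis
  proof (rule that[of v f])
    show "u0 \<le> v" by fact
    have "continuous_on {u0..v} S"
      by (intro continuous_at_imp_continuous_on) (meson S' DERIV_isCont atLeastAtMost_iff)
    then have "continuous_on ({..u0} \<union> {u0..v}) f"
      unfolding f_def using start
      by (intro continuous_on_If continuous_on_hugoniot_excess continuous_intros) auto
    moreover have "{..u0} \<union> {u0..v} = {..v}" using Sv(1) by auto
    ultimately show "continuous_on {..v} f" by simp
    show "f u0 = w" "f v = 0" using start Sv by (simp_all add: f_def)
    show low: "f u \<ge> w + (u0 - u) / 2" if "u \<le> u0" for u
      using that first_hugoniot_excess_ge[OF assms, of "u - u0"] start
      by (cases "u = u0") (auto simp: f_def field_simps)
    show "f u > 0" if "u < v" for u
    proof (cases "u < u0")
      case True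
      then show ?thesis using low[OF less_imp_le[OF True]] assms by argo
    next
      case False
      then show ?thesis using S_gt[of u] that by (simp add: f_def one_less_power)
    qed
    show "lax_shock First u0 (q_crit u0 + w) u (q_crit u + f u)" if "u < u0" for u
      using lax_shock_First_hugoniot[OF assms, of "u - u0" u0] that by (simp add: f_def)
    show "rarefaction First u0 (q_crit u0 + w) u (q_crit u + f u)" if "u0 < u" "u \<le> v" for u
    proof -
      have "S x > 0" if "u0 \<le> x" "x \<le> u" for x
        using S_gt[of x] Sv(3) that \<open>u \<le> v\<close> by (cases "x = v") auto
      then have "rarefaction First u0 (q_crit u0 + ((S u0)\<^sup>2 - 1) / 8) u (q_crit u + ((S u)\<^sup>2 - 1) / 8)"
        using S' that by (intro rarefactionI) auto
      then show ?thesis using that start by (simp add: f_def)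
    qed
  qed
qed

text \<open>
  The middle states that reach the right state by a wave of the second family.  Unlike the curve of
  the first family this one is a graph over the whole line, and it touches the critical curve only
  if the right state lies there.
\<close>

lemma second_wave_curve:
  assumes "w \<ge> 0"
  obtains g where "continuous_on UNIV g" "\<And>u. g u \<ge> 0"
    and "\<And>u. u \<le> u0 \<Longrightarrow> g u \<le> w"
    and "\<And>u. w > 0 \<or> u > u0 \<Longrightarrow> g u > 0"
    and "\<And>u. wave Second u (q_crit u + g u) u0 (q_crit u0 + w)"
proof -
  obtain S where S0: "S u0 = sqrt (1 + 8 * w)"
      and S_bds: "\<And>u. u \<le> u0 \<Longrightarrow> 1 \<le> S u \<and> S u \<le> sqrt (1 + 8 * w)"
      and S_gt: "\<And>u. sqrt (1 + 8 * w) > 1 \<Longrightarrow> u \<le> u0 \<Longrightarrow> S u > 1"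
      and S': "\<And>u. u \<le> u0 \<Longrightarrow> (S has_real_derivative 2 * (S u - 1) / S u) (at u)"
    by (rule second_rarefaction_profile[of "sqrt (1 + 8 * w)" u0]) (use assms in simp, rule that)
  define g where "g u = (if u \<le> u0 then ((S u)\<^sup>2 - 1) / 8 else hugoniot_excess Second w (u - u0))" for u
  have start: "((S u0)\<^sup>2 - 1) / 8 = w" using S0 assms by simp
  show ?thesis
  proof (rule that[of g])
    have "continuous_on {..u0} S"
      by (intro continuous_at_imp_continuous_on) (meson S' DERIV_isCont atMost_iff)
    then have "continuous_on ({..u0} \<union> {u0..}) g"
      unfolding g_def using start
      by (intro continuous_on_If continuous_on_hugoniot_excess continuous_intros) auto
    moreover have "{..u0} \<union> {u0..} = UNIV" by auto
    ultimately show "continuous_on UNIV g" by simp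
    show pos: "g u > 0" if "w > 0 \<or> u > u0" for u
      using that S_gt[of u] second_hugoniot_excess_gt[OF assms, of "u - u0"] assms
      by (auto simp: g_def one_less_power)
    show "g u \<ge> 0" for u
      using pos[of u] S_bds[of u] by (cases "u \<le> u0") (auto simp: g_def one_le_power)
    show "g u \<le> w" if "u \<le> u0" for u
    proof -
      have "(S u)\<^sup>2 \<le> (sqrt (1 + 8 * w))\<^sup>2"
        using S_bds[OF that] by (intro power_mono) auto
      then show ?thesis using that assms by (simp add: g_def)
    qed
    show "wave Second u (q_crit u + g u) u0 (q_crit u0 + w)" for u
    proof (cases u u0 rule: linorder_cases)
      case less
      have "S x > 0" if "x \<le> u0" for x using S_bds[OF that] by simp
      then have "rarefaction Second u (q_crit u + ((S u)\<^sup>2 - 1) / 8) u0 (q_crit u0 + ((S u0)\<^sup>2 - 1) / 8)"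
        using S' less by (intro rarefactionI) auto
      then show ?thesis using less start by (simp add: g_def wave_def)
    next
      case equal
      then show ?thesis using start by (simp add: g_def wave_def)
    next
      case greater
      then show ?thesis
        using lax_shock_Second_hugoniot[OF assms, of "u - u0" u0] by (simp add: g_def wave_def)
    qed
  qed
qed

text \<open>The constant \<open>s = 1\<close> is an equilibrium of the second-family rarefaction equation.\<close>

lemma wave_Second_critical_curve:
  assumes "v \<le> u"
  shows "wave Second v (q_crit v) u (q_crit u)"
proof (cases "v = u")
  case False
  then have "rarefaction Second v (q_crit v + (1\<^sup>2 - 1) / 8) u (q_crit u + (1\<^sup>2 - 1) / 8)"
    using assms by (intro rarefactionI[where S = "\<lambda>_. 1"]) auto
  then show ?thesis by (simp add: wave_def)
qed (simp add: wave_def)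

section \<open>The Riemann problem\<close>

theorem theorem2p2:
  fixes uL qL uR qR :: real
  assumes "qL \<ge> q_crit uL" and "qR \<ge> q_crit uR"
  shows "\<exists>uM qM. connected_via uL qL uM qM uR qR \<and>
           (if meets_at_critical_curve uL qL uR qR then qM = q_crit uM else qM > q_crit uM)"
proof (cases "meets_at_critical_curve uL qL uR qR")
  case True
  then obtain v where "v \<le> uR" "qR = q_crit uR"
      and "(uL = v \<and> qL = q_crit v) \<or> rarefaction First uL qL v (q_crit v)"
    unfolding meets_at_critical_curve_def by blast
  then have "connected_via uL qL v (q_crit v) uR qR"
    using wave_Second_critical_curve[of v uR] unfolding connected_via_def wave_def by blast
  with True show ?thesis by auto
next
  case False
  define wL wR where "wL = qL - q_crit uL" and "wR = qR - q_crit uR"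
  have w: "wL \<ge> 0" "wR \<ge> 0" "q_crit uL + wL = qL" "q_crit uR + wR = qR"
    using assms by (simp_all add: wL_def wR_def)
  obtain f v where v: "uL \<le> v" and f_cont: "continuous_on {..v} f"
      and fL: "f uL = wL" and fv: "f v = 0" and f_pos: "\<And>u. u < v \<Longrightarrow> f u > 0"
      and f_low: "\<And>u. u \<le> uL \<Longrightarrow> f u \<ge> wL + (uL - u) / 2"
      and shock: "\<And>u. u < uL \<Longrightarrow> lax_shock First uL qL u (q_crit u + f u)"
      and rare: "\<And>u. uL < u \<Longrightarrow> u \<le> v \<Longrightarrow> rarefaction First uL qL u (q_crit u + f u)"
    by (rule first_wave_curve[OF w(1), of uL, unfolded w(3)]) (rule that)
  obtain g where g_cont: "continuous_on UNIV g" and g_nonneg: "\<And>u. g u \<ge> 0"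
      and g_le: "\<And>u. u \<le> uR \<Longrightarrow> g u \<le> wR"
      and g_pos: "\<And>u. wR > 0 \<or> u > uR \<Longrightarrow> g u > 0"
      and second: "\<And>u. wave Second u (q_crit u + g u) uR qR"
    by (rule second_wave_curve[OF w(2), of uR, unfolded w(4)]) (rule that)
  \<comment> \<open>Far enough to the left for \<open>f\<close> to have grown up to \<open>wR\<close>, and left of \<open>uR\<close>, where \<open>g \<le> wR\<close>.\<close>
  define U where "U = min uR (uL - 2 * wR)"
  have U: "U \<le> uR" "U \<le> uL" "U \<le> uL - 2 * wR" "U \<le> v"
    using w v unfolding U_def by linarith+
  have "f U - g U \<ge> 0"
    using f_low[OF U(2)] g_le[OF U(1)] U(3) w(1) by argo
  moreover have "f v - g v \<le> 0" using fv g_nonneg[of v] by simp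
  moreover have "continuous_on {U..v} (\<lambda>u. f u - g u)"
    by (intro continuous_on_diff continuous_on_subset[OF f_cont] continuous_on_subset[OF g_cont]) auto
  ultimately obtain u where u: "u \<le> v" "f u = g u"
    using IVT2'[of "\<lambda>u. f u - g u" v 0 U] U(4) by auto
  have "wave First uL qL u (q_crit u + f u)"
    using shock[of u] rare[of u] u(1) fL w(3) unfolding wave_def
    by (cases u uL rule: linorder_cases) auto
  then have conn: "connected_via uL qL u (q_crit u + f u) uR qR"
    using second[of u] u(2) unfolding connected_via_def by simp
  have "f u > 0"
  proof (rule ccontr)
    assume "\<not> f u > 0"
    then have "u = v" using f_pos[of u] u(1) by linarith
    have "wR = 0" "v \<le> uR" using g_pos[of u] \<open>\<not> f u > 0\<close> u(2) w(2) \<open>u = v\<close> by linarith+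
    moreover have "(uL = v \<and> qL = q_crit v) \<or> rarefaction First uL qL v (q_crit v)"
      using rare[of v] v fv fL w(3) by (cases "uL = v") auto
    ultimately show False
      using False w(4) unfolding meets_at_critical_curve_def by auto
  qed
  with conn False show ?thesis by (intro exI[of _ u] exI[of _ "q_crit u + f u"]) simp
qed

end
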